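(* For all $\nu\ge 0$ and $n=1,2,\ldots$, $$\frac{\partial^{n}}{\partial\nu^{n}}J_{\nu}(0)=\frac{\partial^{n}}{\partial\nu^{n}}I_{\nu}(0)=0.$$
   Context: $J_\nu(t)=\left(\frac t2\right)^{\nu}\sum_{k=0}^{\infty}\frac{(-1)^k(t/2)^{2k}}{k!\,\Gamma(\nu+k+1)}$ is the Bessel function of the first kind and $I_\nu(t)=\left(\frac t2\right)^{\nu}\sum_{k=0}^{\infty}\frac{(t/2)^{2k}}{k!\,\Gamma(\nu+k+1)}$ is the modified Bessel function of the first kind; $\nu$ is the order and $t$ the argument. The statement concerns the $n$-th derivatives with respect to the order at argument $t=0$. From the series, $J_\nu(0)=I_\nu(0)$ equals $1$ for $\nu=0$ and $0$ for $\nu>0$.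
   Formalization: At ν=0 the claim fails, since J_ν(0)=I_ν(0) jumps from 1 at ν=0 to 0 for ν>0 and has no derivative there; for ν=0 the statement instead says that the n-th order derivatives tend to 0 as ν→0+. For ν>0 the claim is as stated. *)

theory Defs
  imports "HOL-Analysis.Analysis"
begin

text \<open>Real powers of a base \<open>x \<ge> 0\<close> with \<open>0\<^sup>0 = 1\<close>. The library has \<open>0 powr 0 = 0\<close>, which
  would give \<open>J\<^sub>0(0) = I\<^sub>0(0) = 0\<close> instead of \<open>1\<close>.\<close>

definition rpow :: "real \<Rightarrow> real \<Rightarrow> real" where
  "rpow x a = (if a = 0 then 1 else x powr a)"

text \<open>The argument \<open>t\<close> is meant to be nonnegative. At a pole, \<open>Gamma\<close> is \<open>0\<close>
  in the library, so that the corresponding term of the series vanishes, as usual.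
  For \<open>\<nu> < 0\<close> and \<open>t = 0\<close> the value is a junk value.\<close>

definition bessel_J :: "real \<Rightarrow> real \<Rightarrow> real" where
  "bessel_J \<nu> t =
     rpow (t / 2) \<nu> * (\<Sum>k. (-1) ^ k * (t / 2) ^ (2 * k) / (fact k * Gamma (\<nu> + real k + 1)))"

definition bessel_I :: "real \<Rightarrow> real \<Rightarrow> real" where
  "bessel_I \<nu> t =
     rpow (t / 2) \<nu> * (\<Sum>k. (t / 2) ^ (2 * k) / (fact k * Gamma (\<nu> + real k + 1)))"

lemma bessel_at_0:
  "bessel_J 0 0 = 1" "bessel_I 0 0 = 1"
  "\<nu> > 0 \<Longrightarrow> bessel_J \<nu> 0 = 0" "\<nu> > 0 \<Longrightarrow> bessel_I \<nu> 0 = 0"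
proof -
  have "(\<lambda>k. (-1) ^ k * (0 / 2) ^ (2 * k) / (fact k * Gamma (0 + real k + 1))) sums
        (\<Sum>k\<in>{0}. (-1) ^ k * (0 / 2) ^ (2 * k) / (fact k * Gamma (0 + real k + 1)) :: real)"
    by (rule sums_finite) auto
  from sums_unique[OF this] show "bessel_J 0 0 = 1"
    by (simp add: bessel_J_def rpow_def)
  have "(\<lambda>k. (0 / 2) ^ (2 * k) / (fact k * Gamma (0 + real k + 1))) sums
        (\<Sum>k\<in>{0}. (0 / 2) ^ (2 * k) / (fact k * Gamma (0 + real k + 1)) :: real)"
    by (rule sums_finite) auto
  from sums_unique[OF this] show "bessel_I 0 0 = 1"
    by (simp add: bessel_I_def rpow_def)
qed (auto simp: bessel_J_def bessel_I_def rpow_def)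

text \<open>At order \<open>0\<close> there is no derivative, not even a one-sided one. The order derivatives at \<open>t = 0\<close>
  therefore make sense there only as limits from positive orders.\<close>

lemma bessel_at_0_not_differentiable:
  "\<not> (\<lambda>\<nu>. bessel_J \<nu> 0) differentiable (at 0 within {0..})"
  "\<not> (\<lambda>\<nu>. bessel_I \<nu> 0) differentiable (at 0 within {0..})"
proof -
  have *: "\<not> f differentiable (at 0 within {0..})"
    if f: "f 0 = 1" "\<And>x. x > 0 \<Longrightarrow> f x = 0" for f :: "real \<Rightarrow> real"
  proof
    assume "f differentiable (at 0 within {0..})"
    then have "continuous (at 0 within {0..}) f"
      by (rule differentiable_imp_continuous_within)
    then have "(f \<longlongrightarrow> 1) (at 0 within {0..})"
      by (simp add: continuous_within f)
    then have "(f \<longlongrightarrow> 1) (at_right 0)"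
      by (rule tendsto_within_subset) auto
    moreover have "(f \<longlongrightarrow> 0) (at_right 0)"
    proof (rule tendsto_eventually)
      show "eventually (\<lambda>x. f x = 0) (at_right 0)"
        using f(2) by (auto simp: eventually_at_right_field intro: exI[of _ 1])
    qed
    ultimately show False
      using tendsto_unique[of "at_right (0::real)" f 1 0] by simp
  qed
  show "\<not> (\<lambda>\<nu>. bessel_J \<nu> 0) differentiable (at 0 within {0..})"
    "\<not> (\<lambda>\<nu>. bessel_I \<nu> 0) differentiable (at 0 within {0..})"
    by (rule *; simp add: bessel_at_0)+
qed

end

theory Submission
  imports Defs
begin

text \<open>At argument 0 the power prefactor vanishes for every positive order, so J and I, as
  functions of the order, are identically 0 on an open half-line. Differentiation is local: all
  derivatives there exist and are 0 (\<open>higher_deriv_eq_0_on_open\<close>,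
  \<open>higher_deriv_differentiable_if_0_on_open\<close>). At order 0 the value jumps to 1, so this
  endpoint is reached only as a limit from the right
  (\<open>higher_deriv_tendsto_0_at_right\<close>).\<close>

lemma higher_deriv_eq_0_on_open:
  fixes f :: "'a::real_normed_field \<Rightarrow> 'a"
  assumes "open S" "\<And>x. x \<in> S \<Longrightarrow> f x = 0" "x \<in> S"
  shows "(deriv ^^ n) f x = 0"
  using assms(3)
proof (induction n arbitrary: x)
  case 0
  then show ?case by (simp add: assms(2))
next
  case (Suc n)
  \<comment> \<open>\<open>deriv\<close> at x sees only the germ of the function, so the induction
    hypothesis is used on a whole neighbourhood of x; hence the induction over arbitrary points of
    the open set.\<close>
  have "eventually (\<lambda>y. (deriv ^^ n) f y = 0) (nhds x)"
    using eventually_nhds_in_open[OF assms(1) Suc.prems] by eventually_elim (rule Suc.IH)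
  then have "deriv ((deriv ^^ n) f) x = deriv (\<lambda>_. 0) x"
    by (intro deriv_cong_ev) auto
  then show ?case by simp
qed

text \<open>\<open>deriv\<close> is total, so an equation \<open>deriv f x = 0\<close> does not by
  itself say that a derivative exists; this lemma supplies existence.\<close>

lemma higher_deriv_differentiable_if_0_on_open:
  fixes f :: "'a::real_normed_field \<Rightarrow> 'a"
  assumes "open S" "\<And>x. x \<in> S \<Longrightarrow> f x = 0" "x \<in> S"
  shows "(deriv ^^ n) f differentiable (at x)"
proof -
  have "((deriv ^^ n) f has_derivative (\<lambda>_. 0)) (at x)"
    by (rule has_derivative_transform_within_open[OF has_derivative_const assms(1,3)])
       (simp add: higher_deriv_eq_0_on_open[OF assms(1,2)])
  then show ?thesis by (rule differentiableI)
qed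

lemma higher_deriv_tendsto_0_at_right:
  fixes f :: "real \<Rightarrow> real"
  assumes "\<And>x. x > a \<Longrightarrow> f x = 0"
  shows "((deriv ^^ n) f \<longlongrightarrow> 0) (at_right a)"
proof (rule tendsto_eventually)
  show "eventually (\<lambda>x. (deriv ^^ n) f x = 0) (at_right a)"
    using eventually_at_right_less
  proof eventually_elim
    case (elim x)
    show ?case
      \<comment> \<open>Each x > a lies in this open set, which excludes a, so a jump of f at a does
        no harm.\<close>
      by (rule higher_deriv_eq_0_on_open[of "{a<..}"]) (use assms elim in auto)
  qed
qed

text \<open>The differentiability of the orders m < n makes the n-th \<open>deriv\<close> a genuine
  derivative. For \<nu> = 0 the claim is read as a right-hand limit, by
  \<open>bessel_at_0_not_differentiable\<close>.\<close>

theorem mainTheorem6: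
  fixes \<nu> :: real and n :: nat
  assumes "\<nu> \<ge> 0" and "n \<ge> 1"
  shows "if \<nu> > 0
    then (\<forall>m<n. (deriv ^^ m) (\<lambda>\<mu>. bessel_J \<mu> 0) differentiable (at \<nu>)) \<and>
         (\<forall>m<n. (deriv ^^ m) (\<lambda>\<mu>. bessel_I \<mu> 0) differentiable (at \<nu>)) \<and>
         (deriv ^^ n) (\<lambda>\<mu>. bessel_J \<mu> 0) \<nu> = 0 \<and>
         (deriv ^^ n) (\<lambda>\<mu>. bessel_I \<mu> 0) \<nu> = 0
    else ((deriv ^^ n) (\<lambda>\<mu>. bessel_J \<mu> 0) \<longlongrightarrow> 0) (at_right \<nu>) \<and>
         ((deriv ^^ n) (\<lambda>\<mu>. bessel_I \<mu> 0) \<longlongrightarrow> 0) (at_right \<nu>)"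
proof -
  let ?J = "\<lambda>\<mu>. bessel_J \<mu> 0" and ?I = "\<lambda>\<mu>. bessel_I \<mu> 0"
  have open_pos: "open {0::real<..}" by simp
  have J: "?J \<mu> = 0" and I: "?I \<mu> = 0" if "\<mu> \<in> {0<..}" for \<mu>
    using that by (simp_all add: bessel_at_0)
  show ?thesis
  proof (cases "\<nu> > 0")
    case True
    then have "\<nu> \<in> {0<..}" by simp
    with True show ?thesis
      using higher_deriv_eq_0_on_open[of _ ?J, OF open_pos J]
        higher_deriv_eq_0_on_open[of _ ?I, OF open_pos I]
        higher_deriv_differentiable_if_0_on_open[of _ ?J, OF open_pos J]
        higher_deriv_differentiable_if_0_on_open[of _ ?I, OF open_pos I]
      by simp
  next
    case False
    with assms(1) have "\<nu> = 0" by simp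
    then show ?thesis
      by (simp add: higher_deriv_tendsto_0_at_right bessel_at_0)
  qed
qed

end
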